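(* Let $n,m\in\mathbb{N}$ with $0<m<n$. The interpolating wavelets $\psi_{n,k}^m$, $k=1,\ldots,2n$, i.e. the functions uniquely determined by the conditions $$\mathcal{W}_n^m=\mathrm{span}\{\psi_{n,k}^m:\ k=1,\ldots,2n\},\qquad \psi_{n,k}^m(y_h^n)=\delta_{h,k},\quad h,k=1,\ldots,2n,$$ have the following analytic form: $$\psi_{n,k}^m(x)=\Phi_{3n}^m(y_k^n,x)-\sum_{h=1}^n\Phi_{n,h}^m(y_k^n)\,\Phi_{3n}^m(x_h^n,x),\qquad k=1,\ldots,2n.$$
   Context: Let $w(x)=1/\sqrt{1-x^2}$ on $[-1,1]$ and $\langle f,g\rangle_{L^2_w}=\int_{-1}^1f(x)g(x)w(x)\,dx$; orthogonality is with respect to this scalar product. Chebyshev nodes: $X_n=\{x_k^n=\cos\frac{(2k-1)\pi}{2n}:\ k=1,\ldots,n\}$. One has $X_n\subset X_{3n}$, and $Y_{2n}=X_{3n}\setminus X_n=\{y_k^n:\ k=1,\ldots,2n\}$. Orthonormal Chebyshev polynomials: $p_0=\sqrt{1/\pi}$, $p_r(x)=\sqrt{2/\pi}\cos(r\arccos x)$ for $r>0$. $K_r(x,y)=\sum_{s=0}^rp_s(x)p_s(y)$. For integers $0<m<N$: $v_N^m(x,y)=\frac1{2m}\sum_{r=N-m}^{N+m-1}K_r(x,y)$, $\Phi_N^m(x,y)=\frac{\pi}{N}v_N^m(x,y)$. Scaling functions of order $N$ and parameter $m$: $\Phi_{N,k}^m(x)=\Phi_N^m(x_k^N,x)$, $k=1,\ldots,N$.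 They are linearly independent, and $\mathcal{V}_N^m=\mathrm{span}\{\Phi_{N,k}^m:\ k=1,\ldots,N\}$, so $\dim\mathcal{V}_N^m=N$. For $0<m<n$ one has $\mathcal{V}_n^m\subset\mathcal{V}_{3n}^m$, and the wavelet (detail) space $\mathcal{W}_n^m$ is the orthogonal complement of $\mathcal{V}_n^m$ in $\mathcal{V}_{3n}^m$; $\dim\mathcal{W}_n^m=2n$. *)

theory Defs
  imports "HOL-Analysis.Analysis" "HOL-Library.Function_Algebras"
begin

text \<open>
  A function on the interval from -1 to 1 is represented by a function on the reals that is
  zero outside of it. The elements of the spaces below are linear combinations of the functions \<open>cheb_p r\<close>, so they
  have this form, and their equality means equality on the interval.
\<close>

global_interpretation real_fun: vector_space "\<lambda>(c::real) (f::real \<Rightarrow> real) x. c * f x"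
  by unfold_locales (auto simp: fun_eq_iff algebra_simps)

definition cheb_weight :: "real \<Rightarrow> real" where
  "cheb_weight x = 1 / sqrt (1 - x\<^sup>2)"

definition cheb_inner :: "(real \<Rightarrow> real) \<Rightarrow> (real \<Rightarrow> real) \<Rightarrow> real" where
  "cheb_inner f g = (LBINT x:{-1..1}. f x * g x * cheb_weight x)"

definition cheb_node :: "nat \<Rightarrow> nat \<Rightarrow> real" where
  "cheb_node n k = cos ((2 * real k - 1) * pi / (2 * real n))"

definition cheb_nodes :: "nat \<Rightarrow> real set" where
  "cheb_nodes n = cheb_node n ` {1..n}"

definition cheb_p :: "nat \<Rightarrow> real \<Rightarrow> real" where
  "cheb_p r x =
    (if x \<in> {-1..1} then if r = 0 then sqrt (1 / pi) else sqrt (2 / pi) * cos (real r * arccos x)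
     else 0)"

definition cheb_K :: "nat \<Rightarrow> real \<Rightarrow> real \<Rightarrow> real" where
  "cheb_K r x y = (\<Sum>s=0..r. cheb_p s x * cheb_p s y)"

text \<open>In the following definitions the first two arguments are \<open>N\<close> and \<open>m\<close>, used only for
  \<open>0 < m\<close> and \<open>m < N\<close>, so that the subtractions on natural numbers are not truncated.\<close>

definition vp_kernel :: "nat \<Rightarrow> nat \<Rightarrow> real \<Rightarrow> real \<Rightarrow> real" where
  "vp_kernel N m x y = 1 / (2 * real m) * (\<Sum>r=N-m..N+m-1. cheb_K r x y)"

definition vp_Phi :: "nat \<Rightarrow> nat \<Rightarrow> real \<Rightarrow> real \<Rightarrow> real" where
  "vp_Phi N m x y = pi / real N * vp_kernel N m x y"

definition scaling_fun :: "nat \<Rightarrow> nat \<Rightarrow> nat \<Rightarrow> real \<Rightarrow> real" where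
  "scaling_fun N m k x = vp_Phi N m (cheb_node N k) x"

definition scaling_space :: "nat \<Rightarrow> nat \<Rightarrow> (real \<Rightarrow> real) set" where
  "scaling_space N m = real_fun.span (scaling_fun N m ` {1..N})"

definition wavelet_space :: "nat \<Rightarrow> nat \<Rightarrow> (real \<Rightarrow> real) set" where
  "wavelet_space n m =
    {f \<in> scaling_space (3 * n) m. \<forall>g\<in>scaling_space n m. cheb_inner f g = 0}"

text \<open>Here \<open>y\<close> enumerates the nodes of order \<open>3 * n\<close> that are not nodes of order \<open>n\<close>. Only the
  values of \<open>y\<close> and \<open>\<psi>\<close> at the indices from 1 to \<open>2 * n\<close> matter.\<close>

definition interpolating_wavelets ::
    "nat \<Rightarrow> nat \<Rightarrow> (nat \<Rightarrow> real) \<Rightarrow> (nat \<Rightarrow> real \<Rightarrow> real) \<Rightarrow> bool" where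
  "interpolating_wavelets n m y \<psi> \<longleftrightarrow>
    wavelet_space n m = real_fun.span (\<psi> ` {1..2*n}) \<and>
    (\<forall>h\<in>{1..2*n}. \<forall>k\<in>{1..2*n}. \<psi> k (y h) = (if h = k then 1 else 0))"

end

theory Submission imports Defs
begin

text \<open>
  By summing Dirichlet kernels, \<open>\<Phi>\<^sub>N(x\<^sub>k, x\<^sub>h) = \<delta>\<^sub>k\<^sub>h\<close> at the nodes of order \<open>N\<close>, so an element of
  a scaling space is determined by its values at these nodes. A product of an element of the
  scaling space of order \<open>3n\<close> and one of order \<open>n\<close> has degree at most \<open>4n + 2m - 2 < 6n\<close>, so
  Gauss--Chebyshev quadrature at the nodes of order \<open>3n\<close> computes their scalar product exactly.
  Testing against \<open>\<Phi>\<^sub>n(x\<^sub>h, \<cdot>)\<close>, an element \<open>f\<close> of the large space lies in the wavelet space iff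
  \<open>f(x\<^sub>h) = - (\<Sum>k. f(y\<^sub>k) \<Phi>\<^sub>n(x\<^sub>h, y\<^sub>k))\<close> for all \<open>h\<close>. Hence \<open>f\<close> is determined by its values at the
  \<open>y\<^sub>k\<close>, and inserting these values of \<open>f(x\<^sub>h)\<close> in the interpolation formula gives the wavelets.
\<close>

section \<open>Moments of the Chebyshev weight\<close>

text \<open>In the variable \<open>arccos x\<close> the integrand is the cosine of a multiple angle,
  so there is an explicit antiderivative inside the interval. The weight is unbounded near the
  endpoints; hence integrability is settled first, and the value follows from the limits of the
  antiderivative.\<close>

lemma cheb_moment:
  fixes r :: nat
  defines "f \<equiv> \<lambda>x. cos (real r * arccos x) * cheb_weight x"
  shows "set_integrable lborel {-1..1} f"
    and "(LBINT x:{-1..1}. f x) = (if r = 0 then pi else 0)"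
proof -
  have pos: "0 < 1 - x\<^sup>2" if "-1 < x" "x < 1" for x :: real
    using that by (simp add: abs_square_less_1 abs_less_iff)
  have cont_arccos: "continuous_on {-1..1} (arccos :: real \<Rightarrow> real)"
    by (rule continuous_on_arccos')
  have cont: "continuous_on {-1<..<1} (\<lambda>x. cos (real r * arccos x) * cheb_weight x)" for r
    unfolding cheb_weight_def using pos
    by (intro continuous_intros) (force intro: continuous_on_subset[OF cont_arccos])+
  have lims: "((F \<circ> real_of_ereal) \<longlongrightarrow> F (-1)) (at_right (ereal (-1)))"
      "((F \<circ> real_of_ereal) \<longlongrightarrow> F 1) (at_left (ereal 1))"
    if "continuous_on {-1..1} F" for F :: "real \<Rightarrow> real"
    using continuous_on_Icc_at_rightD[OF that] continuous_on_Icc_at_leftD[OF that]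
    by (simp_all add: ereal_tendsto_simps1)
  have einterval: "einterval (ereal (-1)) (ereal 1) = {-1<..<1}"
    by (auto simp: einterval_def)
  have der0: "DERIV (\<lambda>x. - arccos x) x :> cheb_weight x" if "-1 < x" "x < 1" for x
    using that by (auto intro!: derivative_eq_intros simp: cheb_weight_def field_simps)
  have isc: "isCont (\<lambda>x. cos (real r * arccos x) * cheb_weight x) x" if "-1 < x" "x < 1" for x r
    using cont[of r] that by (simp add: continuous_on_eq_continuous_at)
  have nonneg: "0 \<le> cheb_weight x" if "-1 < x" "x < 1" for x
    using pos[OF that] by (simp add: cheb_weight_def)
  note FTC0 = interval_integral_FTC_nonneg[of "ereal (-1)" "ereal 1" "\<lambda>x. - arccos x" cheb_weight,
      OF _ _ _ _ lims]
  \<comment> \<open>For a nonnegative integrand the antiderivative \<open>- arccos x\<close> alone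
    yields integrability; the weight then dominates \<open>f\<close> for every
    \<open>r\<close>.\<close>
  have w: "set_integrable lborel {-1<..<1} cheb_weight"
    unfolding einterval[symmetric]
    by (rule FTC0) (use der0 isc[of _ 0] nonneg cont_arccos in \<open>auto intro!: continuous_intros\<close>)
  have f: "set_integrable lborel {-1<..<1} f"
  proof (rule set_integrable_bound[OF w])
    show "set_borel_measurable lborel {-1<..<1} f"
      unfolding f_def set_borel_measurable_def
      using borel_measurable_continuous_on_indicator[OF _ cont[of r]] by simp
    show "AE x in lborel. x \<in> {-1<..<1} \<longrightarrow> norm (f x) \<le> norm (cheb_weight x)"
      unfolding f_def by (simp add: abs_mult mult_left_le_one_le)
  qed
  show "set_integrable lborel {-1..1} f"
    using f by (subst set_integrable_discrete_difference[where X = "{-1, 1}" and B = "{-1<..<1}"]) auto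
  define F where "F x = (if r = 0 then - arccos x else - sin (real r * arccos x) / real r)" for x
  have F: "continuous_on {-1..1} F"
    unfolding F_def by (cases "r = 0") (use cont_arccos in \<open>auto intro!: continuous_intros\<close>)
  have der: "DERIV F x :> f x" if "-1 < x" "x < 1" for x
  proof (cases "r = 0")
    case True
    then show ?thesis using der0[OF that] unfolding F_def f_def by simp
  next
    case False
    then show ?thesis using that pos[OF that] unfolding F_def f_def
      by (auto intro!: derivative_eq_intros simp: cheb_weight_def field_simps)
  qed
  have "(LBINT x=ereal (-1)..ereal 1. f x) = F 1 - F (-1)"
  proof (rule interval_integral_FTC_integrable[OF _ _ _ _ lims[OF F]])
    show "isCont f x" if "ereal (-1) < ereal x" "ereal x < ereal 1" for x
      unfolding f_def using isc that by simp
    show "(F has_vector_derivative f x) (at x)" if "ereal (-1) < ereal x" "ereal x < ereal 1" for x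
      using der that by (simp add: has_real_derivative_iff_has_vector_derivative)
  qed (use f einterval in auto)
  also have "\<dots> = (if r = 0 then pi else 0)"
    by (simp add: F_def)
  finally show "(LBINT x:{-1..1}. f x) = (if r = 0 then pi else 0)"
    by (subst (asm) interval_integral_Icc) auto
qed

section \<open>Cosine sums over the Chebyshev nodes\<close>

lemma two_sin_mult_cos: "2 * sin a * cos b = sin (b + a) - sin (b - a)" for a b :: real
  by (simp add: sin_add sin_diff)

text \<open>Each summand times \<open>2 * sin a\<close> equals
  \<open>sin (2 * k * a) - sin (2 * (k - 1) * a)\<close>, so the sum telescopes.\<close>

lemma cos_odd_multiple_sum:
  "2 * sin a * (\<Sum>k=1..N. cos ((2 * real k - 1) * a)) = sin (2 * real N * a)"
proof (induction N)
  case (Suc N)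
  have "2 * sin a * cos ((2 * real (Suc N) - 1) * a) = sin (2 * real (Suc N) * a) - sin (2 * real N * a)"
    unfolding two_sin_mult_cos by (simp add: algebra_simps)
  with Suc show ?case by (simp add: distrib_left)
qed simp

text \<open>Discrete counterpart of \<open>cheb_moment\<close>. For \<open>r > 0\<close> and
  \<open>a = r * pi / (2 * N)\<close> the telescoped sum is \<open>sin (r * pi) = 0\<close>, and
  \<open>r < 2 * N\<close> keeps \<open>a\<close> strictly between 0 and \<open>pi\<close>, so the
  factor \<open>sin a\<close> cancels.\<close>

lemma cheb_nodes_moment:
  assumes "r < 2 * N"
  shows "(\<Sum>k=1..N. cos (real r * ((2 * real k - 1) * pi / (2 * real N)))) = (if r = 0 then real N else 0)"
proof (cases "r = 0")
  case False
  define a where "a = real r * pi / (2 * real N)"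
  have a: "0 < a" "a < pi" and N: "N > 0" using False assms by (auto simp: a_def field_simps)
  have "2 * real N * a = real r * pi" using N by (simp add: a_def)
  then have "2 * sin a * (\<Sum>k=1..N. cos ((2 * real k - 1) * a)) = 0"
    unfolding cos_odd_multiple_sum by simp
  moreover have "sin a > 0" using a by (rule sin_gt_zero)
  moreover have "(2 * real k - 1) * a = real r * ((2 * real k - 1) * pi / (2 * real N))" for k
    by (simp add: a_def)
  ultimately show ?thesis using False by simp
qed simp

section \<open>Dirichlet kernels and their sums\<close>

definition dirichlet :: "nat \<Rightarrow> real \<Rightarrow> real" where
  "dirichlet r a = 1 + 2 * (\<Sum>s=1..r. cos (real s * a))"

text \<open>The classical closed form, again by telescoping; written as a product, it also covers
  the zeros of \<open>sin (a / 2)\<close>.\<close>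

lemma sin_half_mult_dirichlet: "sin (a / 2) * dirichlet r a = sin ((real r + 1 / 2) * a)"
proof (induction r)
  case (Suc r)
  have "2 * sin (a / 2) * cos (real (Suc r) * a) =
      sin ((real (Suc r) + 1 / 2) * a) - sin ((real r + 1 / 2) * a)"
    unfolding two_sin_mult_cos by (simp add: field_simps)
  with Suc show ?case by (simp add: dirichlet_def distrib_left algebra_simps)
qed (simp add: dirichlet_def)

text \<open>A second telescoping: \<open>2 * sin (a / 2) * sin ((L + 1 / 2) * a)\<close> is
  \<open>cos (L * a) - cos ((L + 1) * a)\<close>.\<close>

lemma sin_half_mult_dirichlet_sum:
  assumes "M \<le> L"
  shows "2 * (sin (a / 2))\<^sup>2 * (\<Sum>r=M..<L. dirichlet r a) = cos (real M * a) - cos (real L * a)"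
  using assms
proof (induction L rule: dec_induct)
  case (step L)
  have "2 * (sin (a / 2))\<^sup>2 * dirichlet L a = 2 * sin (a / 2) * sin ((real L + 1 / 2) * a)"
    by (subst sin_half_mult_dirichlet[symmetric]) (simp add: power2_eq_square)
  also have "\<dots> = cos ((real L + 1 / 2) * a - a / 2) - cos ((real L + 1 / 2) * a + a / 2)"
    by (simp add: cos_add cos_diff)
  also have "(real L + 1 / 2) * a - a / 2 = real L * a" by (simp add: field_simps)
  also have "(real L + 1 / 2) * a + a / 2 = real (Suc L) * a" by (simp add: field_simps)
  finally show ?case using step by (simp add: distrib_left)
qed simp

text \<open>The summands are the odd numbers \<open>2 * r + 1\<close>. The point 0 is treated
  separately because the factor \<open>sin (a / 2)\<close> vanishes there.\<close>

lemma dirichlet_sum_at_0: "M \<le> L \<Longrightarrow> (\<Sum>r=M..<L. dirichlet r 0) = (real L)\<^sup>2 - (real M)\<^sup>2"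
  by (induction L rule: dec_induct) (auto simp: dirichlet_def power2_eq_square algebra_simps)

text \<open>Since \<open>N * a\<close> is a multiple of \<open>pi\<close>, the cosines of
  \<open>(N - m) * a\<close> and \<open>(N + m) * a\<close> both equal
  \<open>cos (N * a) * cos (m * a)\<close>. The bounds on \<open>j\<close> exclude multiples of
  \<open>2 * N\<close>, so \<open>sin (a / 2)\<close> is nonzero and cancels.\<close>

lemma dirichlet_sum_eq_0:
  fixes j :: int
  assumes "m < N" and a: "a = of_int j * pi / real N" and "0 < \<bar>j\<bar>" "\<bar>j\<bar> < 2 * int N"
  shows "(\<Sum>r=N-m..<N+m. dirichlet r a) = 0"
proof -
  have "real N * a = of_int j * pi" using assms by simp
  then have 0: "sin (real N * a) = 0" by (simp add: sin_zero_iff_int2)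
  have "cos (real (N - m) * a) = cos (real N * a - real m * a)"
    using assms by (simp add: of_nat_diff algebra_simps)
  moreover have "cos (real (N + m) * a) = cos (real N * a + real m * a)"
    by (simp add: algebra_simps)
  ultimately have "cos (real (N - m) * a) = cos (real (N + m) * a)"
    using 0 by (simp add: cos_add cos_diff)
  then have "2 * (sin (a / 2))\<^sup>2 * (\<Sum>r=N-m..<N+m. dirichlet r a) = 0"
    by (subst sin_half_mult_dirichlet_sum) auto
  moreover have "sin (a / 2) \<noteq> 0"
  proof
    assume "sin (a / 2) = 0"
    then obtain i :: int where "a / 2 = of_int i * pi" by (auto simp: sin_zero_iff_int2)
    then have "real_of_int j = real_of_int (2 * int N * i)"
      using assms by (simp add: field_simps)
    then have "j = 2 * int N * i" by (simp only: of_int_eq_iff)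
    then have "2 * int N dvd j" by simp
    then show False using assms
      by (meson dvd_imp_le_int not_le zero_less_abs_iff abs_ge_zero zdvd_not_zless dvd_abs_iff)
  qed
  ultimately show ?thesis by simp
qed

section \<open>Chebyshev nodes and the values of the kernels there\<close>

definition cheb_angle :: "nat \<Rightarrow> nat \<Rightarrow> real" where
  "cheb_angle n k = (2 * real k - 1) * pi / (2 * real n)"

lemma cheb_node_eq_cos: "cheb_node n k = cos (cheb_angle n k)"
  by (simp add: cheb_node_def cheb_angle_def)

lemma cheb_angle_bounds:
  assumes "k \<in> {1..n}"
  shows "0 \<le> cheb_angle n k" "cheb_angle n k \<le> pi"
  using assms by (auto simp: cheb_angle_def divide_simps)

lemma cheb_p_cos:
  assumes "0 \<le> t" "t \<le> pi"
  shows "cheb_p r (cos t) = sqrt ((if r = 0 then 1 else 2) / pi) * cos (real r * t)"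
  using assms by (simp add: cheb_p_def arccos_cos)

text \<open>The product formula for cosines splits each summand into the frequencies of
  \<open>t - u\<close> and \<open>t + u\<close>. The smaller normalisation of
  \<open>cheb_p 0\<close> matches the constant term 1 of the Dirichlet kernel.\<close>

lemma cheb_K_cos:
  assumes "0 \<le> t" "t \<le> pi" "0 \<le> u" "u \<le> pi"
  shows "cheb_K r (cos t) (cos u) = (dirichlet r (t - u) + dirichlet r (t + u)) / (2 * pi)"
proof (induction r)
  case 0
  then show ?case using assms by (simp add: cheb_K_def cheb_p_cos dirichlet_def)
next
  case (Suc r)
  define q where "q = sqrt (2 / pi)"
  have "cheb_p (Suc r) (cos t) * cheb_p (Suc r) (cos u)
      = q\<^sup>2 * (cos (real (Suc r) * t) * cos (real (Suc r) * u))"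
    using assms by (simp add: cheb_p_cos power2_eq_square q_def[symmetric] del: of_nat_Suc)
  also have "\<dots> = (2 * cos (real (Suc r) * (t - u)) + 2 * cos (real (Suc r) * (t + u))) / (2 * pi)"
    by (simp add: q_def cos_add cos_diff distrib_left right_diff_distrib field_simps del: of_nat_Suc)
  finally show ?case using Suc
    by (simp add: cheb_K_def dirichlet_def add_divide_distrib algebra_simps del: of_nat_Suc)
qed

text \<open>The angles of two nodes have sum \<open>(k + h - 1) * pi / N\<close> and difference
  \<open>(k - h) * pi / N\<close>, so all Dirichlet sums vanish except that of the difference for
  \<open>k = h\<close>. There it is \<open>(N + m)\<^sup>2 - (N - m)\<^sup>2 = 4 * N * m\<close>,
  which the normalising factors turn into 1.\<close>

lemma vp_Phi_node:
  assumes "0 < m" "m < N" "k \<in> {1..N}" "h \<in> {1..N}"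
  shows "vp_Phi N m (cheb_node N k) (cheb_node N h) = (if k = h then 1 else 0)"
proof -
  let ?t = "cheb_angle N k" and ?u = "cheb_angle N h"
  have set: "{N-m..N+m-1} = {N-m..<N+m}" using assms by auto
  have plus: "(\<Sum>r=N-m..<N+m. dirichlet r (?t + ?u)) = 0"
    by (rule dirichlet_sum_eq_0[where j = "int k + int h - 1"])
      (use assms in \<open>auto simp: cheb_angle_def field_simps\<close>)
  have minus: "(\<Sum>r=N-m..<N+m. dirichlet r (?t - ?u)) = (if k = h then 4 * real N * real m else 0)"
  proof (cases "k = h")
    case True
    then show ?thesis using assms
      by (simp add: dirichlet_sum_at_0 of_nat_diff power2_eq_square algebra_simps)
  next
    case False
    then have "(\<Sum>r=N-m..<N+m. dirichlet r (?t - ?u)) = 0"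
      by (intro dirichlet_sum_eq_0[where j = "int k - int h"])
        (use assms in \<open>auto simp: cheb_angle_def field_simps\<close>)
    then show ?thesis using False by simp
  qed
  have "vp_kernel N m (cheb_node N k) (cheb_node N h)
      = 1 / (2 * real m) * (\<Sum>r=N-m..<N+m. (dirichlet r (?t - ?u) + dirichlet r (?t + ?u)) / (2 * pi))"
    unfolding vp_kernel_def cheb_node_eq_cos set
    using cheb_angle_bounds[of k N] cheb_angle_bounds[of h N] assms by (simp add: cheb_K_cos)
  then show ?thesis
    using assms by (simp add: vp_Phi_def sum_divide_distrib[symmetric] sum.distrib plus minus)
qed

lemma inj_on_cheb_node: "inj_on (cheb_node N) {1..N}"
proof (rule inj_onI)
  fix k h assume "k \<in> {1..N}" "h \<in> {1..N}" "cheb_node N k = cheb_node N h"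
  then show "k = h"
    using cos_inj_pi[of "cheb_angle N k" "cheb_angle N h"]
      cheb_angle_bounds[of k N] cheb_angle_bounds[of h N]
    by (auto simp: cheb_node_eq_cos cheb_angle_def divide_simps split: if_splits)
qed

lemma finite_cheb_nodes [simp]: "finite (cheb_nodes N)"
  by (simp add: cheb_nodes_def)

lemma vp_Phi_nodes:
  assumes "0 < m" "m < N" "u \<in> cheb_nodes N" "v \<in> cheb_nodes N"
  shows "vp_Phi N m u v = (if u = v then 1 else 0)"
  using assms vp_Phi_node[OF assms(1,2)] by (auto simp: cheb_nodes_def)

text \<open>Because \<open>3 * (2 * k - 1) = 2 * (3 * k - 1) - 1\<close>, node \<open>k\<close> of
  order \<open>n\<close> is node \<open>3 * k - 1\<close> of order \<open>3 * n\<close>.\<close>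

lemma cheb_nodes_subset: "cheb_nodes n \<subseteq> cheb_nodes (3 * n)"
proof
  fix z assume "z \<in> cheb_nodes n"
  then obtain k where k: "k \<in> {1..n}" "z = cheb_node n k" by (auto simp: cheb_nodes_def)
  then have "cheb_angle n k = cheb_angle (3 * n) (3 * k - 1)"
    by (simp add: cheb_angle_def of_nat_diff field_simps)
  then have "z = cheb_node (3 * n) (3 * k - 1)" by (simp add: k cheb_node_eq_cos)
  moreover have "3 * k - 1 \<in> {1..3*n}" using k by auto
  ultimately show "z \<in> cheb_nodes (3 * n)" unfolding cheb_nodes_def by blast
qed

section \<open>Gauss--Chebyshev quadrature\<close>

text \<open>The product is a combination of cosines with frequencies \<bar>s - t\<bar> and
  \<open>s + t\<close>, both below \<open>2 * N\<close>. For these the integral moments and the node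
  sums agree up to the factor \<open>pi / N\<close>.\<close>

lemma cheb_p_prod_quadrature:
  assumes "s + t < 2 * N"
  shows "set_integrable lborel {-1..1} (\<lambda>x. cheb_p s x * cheb_p t x * cheb_weight x)"
    and "cheb_inner (cheb_p s) (cheb_p t) = pi / real N * (\<Sum>z\<in>cheb_nodes N. cheb_p s z * cheb_p t z)"
proof -
  \<comment> \<open>The moment lemmas take natural frequencies, so the distance of \<open>s\<close>
    and \<open>t\<close> is formed by cases to avoid truncation.\<close>
  define d where "d = (if s \<le> t then t - s else s - t)"
  define q where "q r = sqrt ((if r = 0 then 1 else 2) / pi)" for r :: nat
  define c where "c = q s * q t / 2"
  have prod: "cheb_p s (cos u) * cheb_p t (cos u) = c * cos (real d * u) + c * cos (real (s + t) * u)"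
    if "0 \<le> u" "u \<le> pi" for u
  proof -
    have "cos (real d * u) = cos (real s * u - real t * u)"
    proof (cases "s \<le> t")
      case True
      then have "real d * u = - (real s * u - real t * u)"
        by (simp add: d_def of_nat_diff algebra_simps)
      then show ?thesis by (simp only: cos_minus)
    qed (simp add: d_def of_nat_diff algebra_simps)
    moreover have "cos (real (s + t) * u) = cos (real s * u + real t * u)" by (simp add: algebra_simps)
    ultimately have "cos (real d * u) + cos (real (s + t) * u) = 2 * cos (real s * u) * cos (real t * u)"
      by (simp add: cos_add cos_diff)
    then have "c * cos (real d * u) + c * cos (real (s + t) * u)
        = c * (2 * cos (real s * u) * cos (real t * u))"
      by (simp only: distrib_left[symmetric])
    then show ?thesis by (simp only: cheb_p_cos[OF that] q_def[symmetric]) (simp add: c_def)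
  qed
  let ?M = "\<lambda>r x. c * (cos (real r * arccos x) * cheb_weight x)"
  have eq: "cheb_p s x * cheb_p t x * cheb_weight x = ?M d x + ?M (s + t) x" if "x \<in> {-1..1}" for x
    using prod[of "arccos x"] that by (simp add: arccos_lbound arccos_ubound distrib_right)
  have int: "set_integrable lborel {-1..1} (?M r)" for r
    by (intro set_integrable_mult_right cheb_moment)
  show "set_integrable lborel {-1..1} (\<lambda>x. cheb_p s x * cheb_p t x * cheb_weight x)"
    using set_integral_add(1)[OF int[of d] int[of "s + t"]]
    by (subst set_integrable_cong[OF refl refl eq]) auto
  have "cheb_inner (cheb_p s) (cheb_p t) = (LBINT x:{-1..1}. ?M d x + ?M (s + t) x)"
    unfolding cheb_inner_def using eq by (intro set_lebesgue_integral_cong) auto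
  also have "\<dots> = c * (if d = 0 then pi else 0) + c * (if s + t = 0 then pi else 0)"
    by (subst set_integral_add(2)[OF int int]) (simp only: set_integral_mult_right cheb_moment)
  also have "\<dots> = pi / real N * (\<Sum>k=1..N. cheb_p s (cheb_node N k) * cheb_p t (cheb_node N k))"
  proof -
    have "(\<Sum>k=1..N. cheb_p s (cheb_node N k) * cheb_p t (cheb_node N k))
      = (\<Sum>k=1..N. c * cos (real d * cheb_angle N k) + c * cos (real (s + t) * cheb_angle N k))"
      using prod cheb_angle_bounds by (intro sum.cong) (auto simp: cheb_node_eq_cos)
    also have "\<dots> = c * (if d = 0 then real N else 0) + c * (if s + t = 0 then real N else 0)"
      unfolding sum.distrib sum_distrib_left[symmetric] cheb_angle_def
      using assms by (subst (1 2) cheb_nodes_moment) (auto simp: d_def)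
    finally show ?thesis using assms by (simp add: distrib_left)
  qed
  also have "(\<Sum>k=1..N. cheb_p s (cheb_node N k) * cheb_p t (cheb_node N k))
      = (\<Sum>z\<in>cheb_nodes N. cheb_p s z * cheb_p t z)"
    unfolding cheb_nodes_def sum.reindex[OF inj_on_cheb_node] by simp
  finally show "cheb_inner (cheb_p s) (cheb_p t)
      = pi / real N * (\<Sum>z\<in>cheb_nodes N. cheb_p s z * cheb_p t z)" .
qed


lemma sum_fun_apply: "(\<Sum>a\<in>A. F a) x = (\<Sum>a\<in>A. F a x)" for F :: "'a \<Rightarrow> real \<Rightarrow> real"
  by (induction A rule: infinite_finite_induct) auto

lemma lincomb_in_span:
  assumes "finite A"
  shows "(\<lambda>x. \<Sum>a\<in>A. c a * F a x) \<in> real_fun.span (F ` A)"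
proof -
  have "(\<lambda>x. \<Sum>a\<in>A. c a * F a x) = (\<Sum>a\<in>A. (\<lambda>x. c a * F a x))"
    by (rule ext) (simp add: sum_fun_apply)
  also have "\<dots> \<in> real_fun.span (F ` A)"
    by (intro real_fun.span_sum real_fun.span_scale real_fun.span_base) auto
  finally show ?thesis .
qed

text \<open>Both sides are bilinear, so basis functions suffice; their indices satisfy
  \<open>s + t \<le> D + E - 2 < 2 * N\<close>. Integrability is carried through the induction
  because additivity of the integral requires it.\<close>

lemma cheb_quadrature:
  assumes "f \<in> real_fun.span (cheb_p ` {..<D})" "g \<in> real_fun.span (cheb_p ` {..<E})" "D + E \<le> 2 * N + 1"
  shows "set_integrable lborel {-1..1} (\<lambda>x. f x * g x * cheb_weight x) \<and>
    cheb_inner f g = pi / real N * (\<Sum>z\<in>cheb_nodes N. f z * g z)"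
proof -
  define P where "P f g \<longleftrightarrow> set_integrable lborel {-1..1} (\<lambda>x. f x * g x * cheb_weight x) \<and>
    cheb_inner f g = pi / real N * (\<Sum>z\<in>cheb_nodes N. f z * g z)" for f g :: "real \<Rightarrow> real"
  have sym: "P f g \<longleftrightarrow> P g f" for f g
    unfolding P_def cheb_inner_def by (simp add: mult.commute)
  have zero: "P 0 g" for g
    by (simp add: P_def cheb_inner_def set_integrable_def set_lebesgue_integral_def)
  have lin: "P ((\<lambda>x. c * f x) + h) g" if f: "P f g" and h: "P h g" for c f h g
  proof -
    have eq: "((\<lambda>x. c * f x) + h) x * g x * cheb_weight x
        = c * (f x * g x * cheb_weight x) + h x * g x * cheb_weight x" for x
      by (simp add: algebra_simps)
    have int: "set_integrable lborel {-1..1} (\<lambda>x. c * (f x * g x * cheb_weight x))"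
        "set_integrable lborel {-1..1} (\<lambda>x. h x * g x * cheb_weight x)"
      using f h by (auto simp: P_def)
    have "cheb_inner ((\<lambda>x. c * f x) + h) g = c * cheb_inner f g + cheb_inner h g"
      unfolding cheb_inner_def eq set_integral_add(2)[OF int] by simp
    also have "\<dots> = pi / real N * (\<Sum>z\<in>cheb_nodes N. ((\<lambda>x. c * f x) + h) z * g z)"
      using f h by (simp add: P_def sum_distrib_left distrib_left distrib_right sum.distrib mult_ac)
    finally show ?thesis
      using set_integral_add(1)[OF int] unfolding P_def eq by blast
  qed
  have base: "P (cheb_p s) (cheb_p t)" if "s < D" "t < E" for s t
    unfolding P_def using cheb_p_prod_quadrature[of s t N] that assms(3) by auto
  \<comment> \<open>The second argument varies first, against a fixed basis function; symmetry makes
    linearity in the first argument applicable to it.\<close>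
  have basis: "P (cheb_p s) g" if "s < D" for s
    using assms(2)
  proof (induction rule: real_fun.span_induct_alt)
    case base
    show ?case using zero sym by blast
  next
    case (step c f g)
    then obtain t where "f = cheb_p t" "t < E" by auto
    then show ?case using base[OF that] step(2) lin sym by blast
  qed
  from assms(1) have "P f g"
  proof (induction rule: real_fun.span_induct_alt)
    case base
    show ?case by (rule zero)
  next
    case (step c f h)
    then show ?case using basis lin by blast
  qed
  then show ?thesis by (simp add: P_def)
qed

section \<open>Scaling spaces: degree and interpolation\<close>

lemma vp_Phi_in_span:
  assumes "0 < m" "m < N"
  shows "vp_Phi N m z \<in> real_fun.span (cheb_p ` {..<N+m})"
proof -
  have K: "(\<lambda>x. cheb_K r z x) \<in> real_fun.span (cheb_p ` {..<N+m})" if "r < N + m" for r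
    unfolding cheb_K_def
    using lincomb_in_span[of "{0..r}" "\<lambda>s. cheb_p s z" cheb_p] that
    by (rule_tac subsetD[OF real_fun.span_mono]) auto
  have "(\<Sum>r=N-m..N+m-1. (\<lambda>x. cheb_K r z x)) \<in> real_fun.span (cheb_p ` {..<N+m})"
    by (rule real_fun.span_sum, rule K) (use assms in auto)
  also have "(\<Sum>r=N-m..N+m-1. (\<lambda>x. cheb_K r z x)) = (\<lambda>x. \<Sum>r=N-m..N+m-1. cheb_K r z x)"
    by (rule ext) (rule sum_fun_apply)
  finally have "(\<lambda>x. pi / real N * (1 / (2 * real m) * (\<Sum>r=N-m..N+m-1. cheb_K r z x)))
      \<in> real_fun.span (cheb_p ` {..<N+m})"
    by (intro real_fun.span_scale)
  then show ?thesis unfolding vp_Phi_def[abs_def] vp_kernel_def .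
qed

text \<open>Indexing the generators by the nodes themselves lets sums over the nodes of order
  \<open>3 * n\<close> be split along the nodes of order \<open>n\<close>.\<close>

lemma scaling_space_eq: "scaling_space N m = real_fun.span (vp_Phi N m ` cheb_nodes N)"
proof -
  have "scaling_fun N m ` {1..N} = vp_Phi N m ` cheb_nodes N"
    by (auto simp: cheb_nodes_def scaling_fun_def[abs_def])
  then show ?thesis by (simp add: scaling_space_def)
qed

text \<open>The identity is linear in \<open>f\<close>, and for a generator it is the Kronecker
  property \<open>vp_Phi_nodes\<close>.\<close>

lemma scaling_space_interpolation:
  assumes "0 < m" "m < N" "f \<in> scaling_space N m"
  shows "f = (\<lambda>x. \<Sum>z\<in>cheb_nodes N. f z * vp_Phi N m z x)"
  using assms(3) unfolding scaling_space_eq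
proof (induction rule: real_fun.span_induct_alt)
  case (step c f g)
  then obtain u where u: "u \<in> cheb_nodes N" "f = vp_Phi N m u" by auto
  have "(\<Sum>z\<in>cheb_nodes N. f z * vp_Phi N m z x) = f x" for x
    using u assms by (simp add: vp_Phi_nodes if_distrib[where f = "\<lambda>a. a * _"] sum.delta' cong: if_cong)
  moreover have "(\<Sum>z\<in>cheb_nodes N. g z * vp_Phi N m z x) = g x" for x
    using fun_cong[OF step(2), of x] by simp
  ultimately show ?case
    by (auto simp: fun_eq_iff distrib_right sum.distrib mult.assoc sum_distrib_left[symmetric])
qed (auto simp: fun_eq_iff)

lemma scaling_space_subset_span:
  assumes "0 < m" "m < N"
  shows "scaling_space N m \<subseteq> real_fun.span (cheb_p ` {..<N+m})"
  unfolding scaling_space_eq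
  by (rule real_fun.span_minimal) (use assms vp_Phi_in_span in auto)

lemma cheb_inner_scaling_spaces:
  assumes "0 < m" "m < n" "f \<in> scaling_space (3 * n) m" "g \<in> scaling_space n m"
  shows "cheb_inner f g = pi / real (3 * n) * (\<Sum>z\<in>cheb_nodes (3 * n). f z * g z)"
  \<comment> \<open>The two bounds add up to \<open>4 * n + 2 * m\<close>, which is below
    \<open>6 * n\<close> because \<open>m < n\<close>.\<close>
  using cheb_quadrature[of f "3 * n + m" g "n + m" "3 * n"]
    scaling_space_subset_span[of m "3 * n"] scaling_space_subset_span[of m n] assms by auto

section \<open>The wavelet space and its interpolating basis\<close>

text \<open>Quadrature turns orthogonality into a linear relation between the values of
  \<open>f\<close> at the nodes of order \<open>n\<close> and at the other nodes of order
  \<open>3 * n\<close>. Testing with \<open>vp_Phi n m z\<close> isolates \<open>f z\<close>; these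
  tests suffice since they span the smaller space.\<close>

lemma wavelet_space_iff:
  assumes "0 < m" "m < n"
  shows "f \<in> wavelet_space n m \<longleftrightarrow> f \<in> scaling_space (3 * n) m \<and>
    (\<forall>z\<in>cheb_nodes n. f z = - (\<Sum>u\<in>cheb_nodes (3 * n) - cheb_nodes n. f u * vp_Phi n m z u))"
proof -
  let ?Y = "cheb_nodes (3 * n) - cheb_nodes n"
  have inner: "cheb_inner f g = pi / real (3 * n) *
      ((\<Sum>z\<in>cheb_nodes n. f z * g z) + (\<Sum>u\<in>?Y. f u * g u))"
    if "f \<in> scaling_space (3 * n) m" "g \<in> scaling_space n m" for g
    unfolding cheb_inner_scaling_spaces[OF assms that]
    by (subst sum.subset_diff[OF cheb_nodes_subset]) (auto simp: add.commute)
  have Phi: "vp_Phi n m z \<in> scaling_space n m" if "z \<in> cheb_nodes n" for z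
    unfolding scaling_space_eq using that by (intro real_fun.span_base) auto
  have delta: "(\<Sum>x\<in>cheb_nodes n. f x * vp_Phi n m z x) = f z" if "z \<in> cheb_nodes n" for z
  proof -
    have "(\<Sum>x\<in>cheb_nodes n. f x * vp_Phi n m z x) = (\<Sum>x\<in>cheb_nodes n. if z = x then f x else 0)"
      using that assms by (intro sum.cong) (auto simp: vp_Phi_nodes)
    then show ?thesis using that by simp
  qed
  show ?thesis
  proof (safe)
    assume f: "f \<in> wavelet_space n m"
    then show V: "f \<in> scaling_space (3 * n) m" by (simp add: wavelet_space_def)
    fix z assume z: "z \<in> cheb_nodes n"
    have "cheb_inner f (vp_Phi n m z) = 0" using f Phi[OF z] by (simp add: wavelet_space_def)
    then show "f z = - (\<Sum>u\<in>?Y. f u * vp_Phi n m z u)"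
      using assms by (simp add: inner[OF V Phi[OF z]] delta[OF z])
  next
    assume V: "f \<in> scaling_space (3 * n) m"
      and f: "\<forall>z\<in>cheb_nodes n. f z = - (\<Sum>u\<in>?Y. f u * vp_Phi n m z u)"
    have "cheb_inner f g = 0" if g: "g \<in> scaling_space n m" for g
    proof -
      \<comment> \<open>Expanding \<open>g\<close> through its values at the nodes of order
        \<open>n\<close> makes the assumed relations applicable; the two parts of the quadrature sum
        then cancel.\<close>
      have "(\<Sum>u\<in>?Y. f u * g u) = (\<Sum>u\<in>?Y. \<Sum>z\<in>cheb_nodes n. g z * (f u * vp_Phi n m z u))"
        by (subst scaling_space_interpolation[OF assms g]) (simp add: sum_distrib_left mult_ac)
      also have "\<dots> = (\<Sum>z\<in>cheb_nodes n. g z * (\<Sum>u\<in>?Y. f u * vp_Phi n m z u))"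
        by (subst sum.swap) (simp add: sum_distrib_left)
      also have "\<dots> = - (\<Sum>z\<in>cheb_nodes n. f z * g z)"
        unfolding sum_negf[symmetric] using f by (intro sum.cong) auto
      finally show ?thesis by (simp add: inner[OF V g])
    qed
    then show "f \<in> wavelet_space n m" using V by (simp add: wavelet_space_def)
  qed
qed

text \<open>Indexed by the node \<open>u\<close> itself, hence independent of the enumeration
  \<open>y\<close>. The coefficients \<open>- vp_Phi n m z u\<close> are the values that
  \<open>wavelet_space_iff\<close> forces at \<open>z\<close> when the values at the other nodes are
  1 at \<open>u\<close> and 0 elsewhere.\<close>

definition wavelet :: "nat \<Rightarrow> nat \<Rightarrow> real \<Rightarrow> real \<Rightarrow> real" where
  "wavelet n m u = (\<lambda>x. vp_Phi (3 * n) m u x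
    - (\<Sum>z\<in>cheb_nodes n. vp_Phi n m z u * vp_Phi (3 * n) m z x))"

text \<open>The kernels of order \<open>3 * n\<close> are Kronecker deltas at \<open>v\<close>, so
  only the term \<open>z = v\<close> of the correction sum can survive.\<close>

lemma wavelet_at_nodes:
  assumes "0 < m" "m < n" "u \<in> cheb_nodes (3 * n) - cheb_nodes n" "v \<in> cheb_nodes (3 * n)"
  shows "wavelet n m u v = (if v \<in> cheb_nodes n then - vp_Phi n m v u else if u = v then 1 else 0)"
proof -
  have *: "vp_Phi (3 * n) m x v = (if x = v then 1 else 0)" if "x \<in> cheb_nodes (3 * n)" for x
    using that assms by (simp add: vp_Phi_nodes)
  have "(\<Sum>z\<in>cheb_nodes n. vp_Phi n m z u * vp_Phi (3 * n) m z v)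
      = (\<Sum>z\<in>cheb_nodes n. if z = v then vp_Phi n m z u else 0)"
    using cheb_nodes_subset[of n] by (intro sum.cong) (auto simp: *)
  then show ?thesis using assms by (auto simp: wavelet_def *)
qed

text \<open>Among the nodes outside \<open>cheb_nodes n\<close> only \<open>u\<close> carries a
  nonzero value, so the sum in \<open>wavelet_space_iff\<close> reduces to
  \<open>vp_Phi n m z u\<close>.\<close>

lemma wavelet_in_wavelet_space:
  assumes "0 < m" "m < n" "u \<in> cheb_nodes (3 * n) - cheb_nodes n"
  shows "wavelet n m u \<in> wavelet_space n m"
  unfolding wavelet_space_iff[OF assms(1,2)]
proof (intro conjI ballI)
  let ?S = "scaling_space (3 * n) m"
  have Phi: "vp_Phi (3 * n) m z \<in> ?S" if "z \<in> cheb_nodes (3 * n)" for z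
    unfolding scaling_space_eq using that by (intro real_fun.span_base) auto
  have "(\<lambda>x. \<Sum>z\<in>cheb_nodes n. vp_Phi n m z u * vp_Phi (3 * n) m z x) \<in> ?S"
    unfolding scaling_space_eq
    by (rule subsetD[OF real_fun.span_mono lincomb_in_span]) (use cheb_nodes_subset in auto)
  from real_fun.span_diff[OF Phi[unfolded scaling_space_eq] this[unfolded scaling_space_eq]]
  show "wavelet n m u \<in> ?S"
    using assms unfolding scaling_space_eq wavelet_def by (auto simp: fun_diff_def)
  fix z assume z: "z \<in> cheb_nodes n"
  have "(\<Sum>v\<in>cheb_nodes (3 * n) - cheb_nodes n. wavelet n m u v * vp_Phi n m z v)
      = (\<Sum>v\<in>cheb_nodes (3 * n) - cheb_nodes n. if u = v then vp_Phi n m z v else 0)"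
    using assms by (intro sum.cong) (auto simp: wavelet_at_nodes)
  also have "\<dots> = vp_Phi n m z u" using assms by simp
  finally show "wavelet n m u z
      = - (\<Sum>v\<in>cheb_nodes (3 * n) - cheb_nodes n. wavelet n m u v * vp_Phi n m z v)"
    using assms z cheb_nodes_subset[of n] by (simp add: wavelet_at_nodes subset_eq)
qed

text \<open>Interpolate \<open>f\<close> at all nodes of order \<open>3 * n\<close>, replace its
  values at the nodes of order \<open>n\<close> by \<open>wavelet_space_iff\<close>, and collect the
  terms belonging to each \<open>u\<close>. This gives both spanning and uniqueness.\<close>

lemma wavelet_space_expansion:
  assumes "0 < m" "m < n" "f \<in> wavelet_space n m"
  shows "f = (\<lambda>x. \<Sum>u\<in>cheb_nodes (3 * n) - cheb_nodes n. f u * wavelet n m u x)"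
proof
  fix x
  let ?Y = "cheb_nodes (3 * n) - cheb_nodes n"
  have V: "f \<in> scaling_space (3 * n) m"
    and f: "\<And>z. z \<in> cheb_nodes n \<Longrightarrow> f z = - (\<Sum>u\<in>?Y. f u * vp_Phi n m z u)"
    using assms wavelet_space_iff by auto
  have "f x = (\<Sum>z\<in>cheb_nodes (3 * n). f z * vp_Phi (3 * n) m z x)"
    by (rule fun_cong[OF scaling_space_interpolation]) (use assms V in auto)
  also have "\<dots> = (\<Sum>u\<in>?Y. f u * vp_Phi (3 * n) m u x)
      + (\<Sum>z\<in>cheb_nodes n. f z * vp_Phi (3 * n) m z x)"
    by (rule sum.subset_diff[OF cheb_nodes_subset]) simp
  also have "(\<Sum>z\<in>cheb_nodes n. f z * vp_Phi (3 * n) m z x)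
      = (\<Sum>z\<in>cheb_nodes n. \<Sum>u\<in>?Y. - (f u * (vp_Phi n m z u * vp_Phi (3 * n) m z x)))"
    by (intro sum.cong refl, subst f) (simp_all add: sum_distrib_right sum_negf mult.assoc)
  also have "\<dots> = - (\<Sum>u\<in>?Y. f u * (\<Sum>z\<in>cheb_nodes n. vp_Phi n m z u * vp_Phi (3 * n) m z x))"
    by (subst sum.swap) (simp add: sum_distrib_left sum_negf)
  finally show "f x = (\<Sum>u\<in>?Y. f u * wavelet n m u x)"
    by (simp add: wavelet_def right_diff_distrib sum_subtractf)
qed

theorem theorem4p1:
  fixes n m :: nat and y :: "nat \<Rightarrow> real" and \<psi> :: "nat \<Rightarrow> real \<Rightarrow> real"
  assumes "0 < m" and "m < n"
    and "bij_betw y {1..2*n} (cheb_nodes (3*n) - cheb_nodes n)"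
  shows "interpolating_wavelets n m y \<psi> \<longleftrightarrow>
    (\<forall>k\<in>{1..2*n}. \<psi> k =
      (\<lambda>x. vp_Phi (3*n) m (y k) x
            - (\<Sum>h=1..n. scaling_fun n m h (y k) * vp_Phi (3*n) m (cheb_node n h) x)))"
proof -
  let ?Y = "cheb_nodes (3 * n) - cheb_nodes n"
  have formula: "(\<lambda>x. vp_Phi (3*n) m u x
      - (\<Sum>h=1..n. scaling_fun n m h u * vp_Phi (3*n) m (cheb_node n h) x)) = wavelet n m u" for u
    unfolding wavelet_def scaling_fun_def cheb_nodes_def sum.reindex[OF inj_on_cheb_node] by simp
  have Y: "y k \<in> ?Y" if "k \<in> {1..2*n}" for k
    using bij_betwE[OF assms(3)] that by blast
  have image: "y ` {1..2*n} = ?Y" and inj: "inj_on y {1..2*n}"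
    using assms(3) by (auto simp: bij_betw_def)
  have "interpolating_wavelets n m y \<psi> \<longleftrightarrow> (\<forall>k\<in>{1..2*n}. \<psi> k = wavelet n m (y k))"
  proof
    assume \<psi>: "interpolating_wavelets n m y \<psi>"
    show "\<forall>k\<in>{1..2*n}. \<psi> k = wavelet n m (y k)"
    proof
      fix k assume k: "k \<in> {1..2*n}"
      then have "\<psi> k \<in> real_fun.span (\<psi> ` {1..2*n})" by (intro real_fun.span_base) auto
      then have "\<psi> k \<in> wavelet_space n m" using \<psi> by (simp add: interpolating_wavelets_def)
      \<comment> \<open>The prescribed values at the points \<open>y h\<close> are now the
        coefficients of the expansion, and only the one for \<open>h = k\<close> is nonzero.\<close>
      then have "\<psi> k = (\<lambda>x. \<Sum>u\<in>?Y. \<psi> k u * wavelet n m u x)"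
        by (rule wavelet_space_expansion[OF assms(1,2)])
      also have "\<dots> = (\<lambda>x. \<Sum>h\<in>{1..2*n}. \<psi> k (y h) * wavelet n m (y h) x)"
        unfolding image[symmetric] sum.reindex[OF inj] by simp
      also have "\<dots> = (\<lambda>x. \<Sum>h\<in>{1..2*n}. if h = k then wavelet n m (y h) x else 0)"
        using \<psi> k by (intro ext sum.cong) (auto simp: interpolating_wavelets_def)
      also have "\<dots> = wavelet n m (y k)" using k by simp
      finally show "\<psi> k = wavelet n m (y k)" .
    qed
  next
    assume \<psi>: "\<forall>k\<in>{1..2*n}. \<psi> k = wavelet n m (y k)"
    have span: "real_fun.span (\<psi> ` {1..2*n}) = real_fun.span (wavelet n m ` ?Y)"
      unfolding image[symmetric] image_image using \<psi> by (metis (no_types, lifting) image_cong)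
    have "wavelet_space n m = real_fun.span (wavelet n m ` ?Y)"
    proof
      show "wavelet_space n m \<subseteq> real_fun.span (wavelet n m ` ?Y)"
      proof
        fix f assume "f \<in> wavelet_space n m"
        from wavelet_space_expansion[OF assms(1,2) this] show "f \<in> real_fun.span (wavelet n m ` ?Y)"
          using lincomb_in_span[of ?Y f "wavelet n m"] by simp
      qed
      show "real_fun.span (wavelet n m ` ?Y) \<subseteq> wavelet_space n m"
      proof
        fix f assume "f \<in> real_fun.span (wavelet n m ` ?Y)"
        then show "f \<in> wavelet_space n m"
        proof (induction rule: real_fun.span_induct_alt)
          case base
          have "0 \<in> scaling_space (3 * n) m" unfolding scaling_space_def by (rule real_fun.span_zero)
          then show ?case using assms by (simp add: wavelet_space_iff zero_fun_def)
        next
          case (step c f g)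
          then have f: "f \<in> wavelet_space n m" using wavelet_in_wavelet_space assms by blast
          have "(\<lambda>x. c * f x) + g \<in> scaling_space (3 * n) m"
            using f step(2) unfolding wavelet_space_def scaling_space_def
            by (intro real_fun.span_add real_fun.span_scale) auto
          \<comment> \<open>The relations of \<open>wavelet_space_iff\<close> are linear in the
            function, so they pass to the combination without any integrals.\<close>
          then show ?case using f step(2) assms
            by (auto simp: wavelet_space_iff plus_fun_def distrib_right sum.distrib sum_distrib_left mult.assoc
                sum_negf[symmetric])
        qed
      qed
    qed
    moreover have "\<psi> k (y h) = (if h = k then 1 else 0)" if "h \<in> {1..2*n}" "k \<in> {1..2*n}" for h k
      using that Y[OF that(1)] Y[OF that(2)] \<psi> inj_onD[OF inj, of k h] assms
      by (auto simp: wavelet_at_nodes)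
    ultimately show "interpolating_wavelets n m y \<psi>"
      unfolding interpolating_wavelets_def span by blast
  qed
  then show ?thesis unfolding formula .
qed

end
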